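(* There exists a multiple unicast instance $\langle G,\{s_1-t_1,s_2-t_2\},\{2,1\}\rangle$ with two sessions, of rates $R_1=2$ and $R_2=1$, and with connectivity level $[2~3]$, that is infeasible.
   Context: A network is a finite directed acyclic graph $G=(V,E)$ (parallel edges allowed) in which every edge has unit capacity. A multiple unicast instance $\langle G,\{s_i-t_i\}_1^n,\{R_i\}_1^n\rangle$ consists of $G$ together with source nodes $s_1,\dots,s_n$ and terminal nodes $t_1,\dots,t_n$ in $V$ and positive integer rates $R_i$; source nodes have no incoming edges and terminal nodes have no outgoing edges. Source node $s_i$ observes $R_i$ independent unit-entropy messages, all of which are to be communicated to $t_i$; messages of different sources are independent. The connectivity level is the vector $[k_1~\dots~k_n]$ where $k_i$ is the maximum flow from $s_i$ to $t_i$ in $G$. Coding strategies (possibly nonlinear): for a finite alphabet $\mathcal{X}$ with $|\mathcal{X}|\ge 2$ and block length $T$, the unit-entropy messages are independent and uniformly distributed on $\mathcal{X}^T$; each edge carries an element of $\mathcal{X}^T$ which is an arbitrary function of what is carried on the incoming edges of its tail and of the messages observed at its tail; each terminal $t_i$ estimates the messages of $s_i$ by an arbitrary function of what is carried on its incoming edges. The instance is infeasible if, for every such alphabet $\mathcal{X}$, there is no sequence of such codes with $T\to\infty$ for which the probability that some terminal decodes incorrectly tends to $0$ (in particular, there is no zero-error code, linear or nonlinear, for any $T$). *)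

theory Defs
  imports "HOL-Probability.Probability" "Graph_Theory.Digraph"
begin

section \<open>Networks and maximum flows\<close>

text \<open>Parallel edges are allowed, since arcs have an identity of their own; acyclicity of the
  arc relation also excludes loops.\<close>

locale network = fin_digraph +
  assumes acyclic_arcs_ends: "acyclic (arcs_ends G)"

definition unit_capacity_flow :: "('v, 'e) pre_digraph \<Rightarrow> 'v \<Rightarrow> 'v \<Rightarrow> ('e \<Rightarrow> real) \<Rightarrow> bool" where
  "unit_capacity_flow G s t f \<longleftrightarrow>
     (\<forall>e \<in> arcs G. 0 \<le> f e \<and> f e \<le> 1) \<and>
     (\<forall>v \<in> verts G - {s, t}. (\<Sum>e \<in> in_arcs G v. f e) = (\<Sum>e \<in> out_arcs G v. f e))"

definition flow_value :: "('v, 'e) pre_digraph \<Rightarrow> 'v \<Rightarrow> ('e \<Rightarrow> real) \<Rightarrow> real" where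
  "flow_value G s f = (\<Sum>e \<in> out_arcs G s. f e) - (\<Sum>e \<in> in_arcs G s. f e)"

definition max_flow :: "('v, 'e) pre_digraph \<Rightarrow> 'v \<Rightarrow> 'v \<Rightarrow> real" where
  "max_flow G s t = (GREATEST k. \<exists>f. unit_capacity_flow G s t f \<and> flow_value G s f = k)"


section \<open>Network codes\<close>

definition blocks :: "'x set \<Rightarrow> nat \<Rightarrow> 'x list set" where
  "blocks X T = {w. set w \<subseteq> X \<and> length w = T}"

text \<open>A message is named by a pair \<open>(i, j)\<close>: the \<open>j\<close>-th message of session \<open>i\<close>.
  The first argument of \<open>encode C e\<close> gives the contents of the edges entering
  the tail of \<open>e\<close>, the second one the messages observed there.
  The first argument of \<open>decode C i\<close> gives the contents of the edges entering the \<open>i\<close>-th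
  terminal, and \<open>decode C i y j\<close> is the estimate of message \<open>(i, j)\<close>.\<close>

record ('e, 'x) network_code =
  encode :: "'e \<Rightarrow> ('e \<Rightarrow> 'x list) \<Rightarrow> (nat \<times> nat \<Rightarrow> 'x list) \<Rightarrow> 'x list"
  decode :: "nat \<Rightarrow> ('e \<Rightarrow> 'x list) \<Rightarrow> nat \<Rightarrow> 'x list"


section \<open>Multiple unicast instances\<close>

text \<open>Sessions are numbered from \<open>0\<close>, as positions in the lists.\<close>

locale multiple_unicast = network G for G :: "('v, 'e) pre_digraph" (structure) +
  fixes sources terminals :: "'v list" and rates :: "nat list"
  assumes length_terminals: "length terminals = length sources"
    and length_rates: "length rates = length sources"
    and sources_in_verts: "set sources \<subseteq> verts G"
    and terminals_in_verts: "set terminals \<subseteq> verts G"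
    and in_arcs_source: "s \<in> set sources \<Longrightarrow> in_arcs G s = {}"
    and out_arcs_terminal: "t \<in> set terminals \<Longrightarrow> out_arcs G t = {}"
    and rates_pos: "r \<in> set rates \<Longrightarrow> 0 < r"
begin

definition connectivity_level :: "real list" where
  "connectivity_level = map2 (max_flow G) sources terminals"

definition messages :: "(nat \<times> nat) set" where
  "messages = (SIGMA i : {..<length sources}. {..<rates ! i})"

definition observed :: "'v \<Rightarrow> (nat \<times> nat) set" where
  "observed v = {(i, j) \<in> messages. sources ! i = v}"

definition block_code :: "'x set \<Rightarrow> nat \<Rightarrow> ('e, 'x) network_code \<Rightarrow> bool" where
  "block_code X T C \<longleftrightarrow>
     (\<forall>e \<in> arcs G.
        \<forall>y \<in> in_arcs G (tail G e) \<rightarrow>\<^sub>E blocks X T. \<forall>m \<in> observed (tail G e) \<rightarrow>\<^sub>E blocks X T.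
          encode C e y m \<in> blocks X T) \<and>
     (\<forall>i < length sources.
        \<forall>y \<in> in_arcs G (terminals ! i) \<rightarrow>\<^sub>E blocks X T. \<forall>j < rates ! i.
          decode C i y j \<in> blocks X T)"

definition arc_before :: "('e \<times> 'e) set" where
  "arc_before = {(e', e). e \<in> arcs G \<and> e' \<in> in_arcs G (tail G e)}"

text \<open>The contents of the edges when the messages are \<open>m\<close>, by recursion along the acyclic graph;
  see \<open>carried_eq\<close> below.\<close>

definition carried :: "('e, 'x) network_code \<Rightarrow> (nat \<times> nat \<Rightarrow> 'x list) \<Rightarrow> 'e \<Rightarrow> 'x list" where
  "carried C m = wfrec arc_before
     (\<lambda>z e. encode C e (restrict z (in_arcs G (tail G e))) (restrict m (observed (tail G e))))"

definition message_pmf :: "'x set \<Rightarrow> nat \<Rightarrow> (nat \<times> nat \<Rightarrow> 'x list) pmf" where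
  "message_pmf X T = Pi_pmf messages undefined (\<lambda>_. pmf_of_set (blocks X T))"

definition error_prob :: "'x set \<Rightarrow> nat \<Rightarrow> ('e, 'x) network_code \<Rightarrow> real" where
  "error_prob X T C = measure_pmf.prob (message_pmf X T)
     {m. \<exists>(i, j) \<in> messages.
           decode C i (restrict (carried C m) (in_arcs G (terminals ! i))) j \<noteq> m (i, j)}"

text \<open>Every finite alphabet is, up to renaming its letters, a finite set of natural numbers.\<close>

definition infeasible :: bool where
  "infeasible \<longleftrightarrow>
     (\<forall>X :: nat set. finite X \<and> 2 \<le> card X \<longrightarrow>
        \<not> (\<exists>T C. filterlim T at_top sequentially \<and>
                  (\<forall>k. block_code X (T k) (C k)) \<and>
                  (\<lambda>k. error_prob X (T k) (C k)) \<longlonglongrightarrow> 0))"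

lemma wf_arc_before: "wf arc_before"
proof (rule finite_acyclic_wf)
  have "arc_before \<subseteq> arcs G \<times> arcs G"
    by (auto simp: arc_before_def in_arcs_def)
  then show "finite arc_before"
    by (rule finite_subset) simp
  have "(tail G e', tail G e) \<in> (arcs_ends G)\<^sup>+" if "(e', e) \<in> arc_before\<^sup>+" for e' e
    using that
  proof induction
    case (base e)
    then show ?case
      by (auto simp: arc_before_def in_arcs_def arcs_ends_conv intro!: r_into_trancl)
  next
    case (step e e'')
    then have "(tail G e, tail G e'') \<in> arcs_ends G"
      by (auto simp: arc_before_def in_arcs_def arcs_ends_conv)
    with step.IH show ?case by (rule trancl_into_trancl)
  qed
  then show "acyclic arc_before"
    using acyclic_arcs_ends by (auto simp: acyclic_def)
qed

lemma carried_eq: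
  assumes "e \<in> arcs G"
  shows "carried (C :: ('e, 'x) network_code) m e =
           encode C e (restrict (carried C m) (in_arcs G (tail G e)))
             (restrict m (observed (tail G e)))"
proof -
  have "restrict (cut z arc_before e) (in_arcs G (tail G e)) = restrict z (in_arcs G (tail G e))"
    for z :: "'e \<Rightarrow> 'x list"
    using assms by (intro restrict_ext) (simp add: cut_apply arc_before_def)
  then show ?thesis
    unfolding carried_def by (subst wfrec[OF wf_arc_before]) simp
qed

end

end

theory Submission
  imports Defs
begin

text \<open>The network is the union of two paths from \<open>s\<^sub>1\<close> to \<open>t\<^sub>1\<close> and three paths from \<open>s\<^sub>2\<close> to \<open>t\<^sub>2\<close>
  that share four edges. With \<open>x\<close> the pair of messages of session 1, \<open>y\<close> the message of
  session 2, \<open>a, b\<close> sent by \<open>s\<^sub>1\<close> and \<open>c\<^sub>1, c\<^sub>2, c\<^sub>3\<close> sent by \<open>s\<^sub>2\<close>, these edges carry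
  \<open>e\<^sub>1 = f(a, c\<^sub>1)\<close>, \<open>e\<^sub>2 = g(e\<^sub>1, c\<^sub>2)\<close>, \<open>e\<^sub>3 = h(b, e\<^sub>2)\<close> and \<open>e\<^sub>4 = k(e\<^sub>3, c\<^sub>3)\<close>;
  \<open>t\<^sub>1\<close> sees \<open>e\<^sub>2, e\<^sub>4\<close> and \<open>t\<^sub>2\<close> sees \<open>e\<^sub>1, e\<^sub>3, e\<^sub>4\<close>.
  Let \<open>n\<close> be the number of blocks. Since \<open>t\<^sub>1\<close> recovers one of \<open>n\<^sup>2\<close> values of \<open>x\<close> from one of
  \<open>n\<^sup>2\<close> values of \<open>(e\<^sub>2, e\<^sub>4)\<close>, this pair, and hence also \<open>e\<^sub>3\<close>, depends (up to decoding errors)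
  on \<open>x\<close> only. For fixed \<open>y\<close> the pair \<open>(e\<^sub>1, e\<^sub>3)\<close> determines \<open>(e\<^sub>2, e\<^sub>4)\<close> and so \<open>x\<close>: it takes
  almost \<open>n\<^sup>2\<close> values. But \<open>t\<^sub>2\<close> needs the sets of values for different \<open>y\<close> to be disjoint,
  although all of them lie in a set of size \<open>n\<^sup>2\<close>. Quantitatively, the error probability is
  at least 1/12.\<close>

section \<open>Counting pairs of message values that lead to decoding errors\<close>

lemma card_le_bad_pair:
  fixes e1 e2 e3 e4 :: "'x \<Rightarrow> 'y \<Rightarrow> 'w"
  assumes fin: "finite A" "finite B" and card_A: "card A = card B ^ 2"
    and in_B: "\<And>x y. x \<in> A \<Longrightarrow> y \<in> Y \<Longrightarrow>
        e1 x y \<in> B \<and> e2 x y \<in> B \<and> e3 x y \<in> B \<and> e4 x y \<in> B"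
    and e2: "\<And>x x' y. x \<in> A \<Longrightarrow> x' \<in> A \<Longrightarrow> y \<in> Y \<Longrightarrow> e1 x y = e1 x' y \<Longrightarrow> e2 x y = e2 x' y"
    and e3: "\<And>x y y'. x \<in> A \<Longrightarrow> y \<in> Y \<Longrightarrow> y' \<in> Y \<Longrightarrow> e2 x y = e2 x y' \<Longrightarrow> e3 x y = e3 x y'"
    and e4: "\<And>x x' y. x \<in> A \<Longrightarrow> x' \<in> A \<Longrightarrow> y \<in> Y \<Longrightarrow> e3 x y = e3 x' y \<Longrightarrow> e4 x y = e4 x' y"
    and decode_x: "\<And>x x' y y'. x \<in> A \<Longrightarrow> x' \<in> A \<Longrightarrow> y \<in> Y \<Longrightarrow> y' \<in> Y \<Longrightarrow>
        \<not> bad x y \<Longrightarrow> \<not> bad x' y' \<Longrightarrow> e2 x y = e2 x' y' \<Longrightarrow> e4 x y = e4 x' y' \<Longrightarrow> x = x'"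
    and decode_y: "\<And>x x' y y'. x \<in> A \<Longrightarrow> x' \<in> A \<Longrightarrow> y \<in> Y \<Longrightarrow> y' \<in> Y \<Longrightarrow>
        \<not> bad x y \<Longrightarrow> \<not> bad x' y' \<Longrightarrow> e1 x y = e1 x' y' \<Longrightarrow> e3 x y = e3 x' y' \<Longrightarrow>
        e4 x y = e4 x' y' \<Longrightarrow> y = y'"
    and y: "y \<in> Y" and y': "y' \<in> Y" and "y \<noteq> y'"
  shows "card A \<le> 4 * card {x \<in> A. bad x y} + 2 * card {x \<in> A. bad x y'}"
proof -
  define G where "G = {x \<in> A. \<not> bad x y}"
  define G' where "G' = {x \<in> A. \<not> bad x y'}"
  define p where "p = (\<lambda>x. (e2 x y, e4 x y))"
  define p' where "p' = (\<lambda>x. (e2 x y', e4 x y'))"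
  define q where "q = (\<lambda>x. (e1 x y, e3 x y))"
  define q' where "q' = (\<lambda>x. (e1 x y', e3 x y'))"
  \<comment> \<open>\<open>V\<close> collects the good \<open>x\<close> whose pair
    \<open>(e2, e4)\<close> is the same at \<open>y\<close> and at \<open>y'\<close>; for these
    \<open>e3\<close> agrees as well.\<close>
  define V where "V = {x \<in> G \<inter> G'. p x = p' x}"
  have fin': "finite V" "finite G" "finite G'" "finite (B \<times> B)"
    using fin by (auto simp: V_def G_def G'_def)
  have card_BB: "card (B \<times> B) = card A"
    by (simp add: card_cartesian_product card_A power2_eq_square)

  \<comment> \<open>Where the pairs at \<open>y\<close> and \<open>y'\<close> differ, \<open>p'\<close> avoids \<open>p ` G\<close>, as both are decoded to \<open>x\<close>.\<close>
  have "card (G \<inter> G' - V) \<le> card (B \<times> B - p ` G)"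
  proof (rule card_inj_on_le)
    show "inj_on p' (G \<inter> G' - V)"
      using decode_x y' by (auto simp: inj_on_def G_def G'_def p'_def)
    show "p' ` (G \<inter> G' - V) \<subseteq> B \<times> B - p ` G"
    proof
      fix w assume "w \<in> p' ` (G \<inter> G' - V)"
      then obtain x where x: "x \<in> G" "x \<in> G'" "x \<notin> V" and w: "w = p' x" by auto
      have "p' x \<noteq> p x'" if "x' \<in> G" for x'
      proof
        assume eq: "p' x = p x'"
        then have "x = x'"
          using decode_x[of x x' y' y] x that y y' by (auto simp: p_def p'_def G_def G'_def)
        with eq x show False by (simp add: V_def)
      qed
      then show "w \<in> B \<times> B - p ` G"
        using in_B y' x by (auto simp: w p'_def G'_def)
    qed
  qed (use fin' in auto)
  moreover have "card (p ` G) = card G"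
    using decode_x y by (intro card_image) (auto simp: inj_on_def G_def p_def)
  moreover have "card (B \<times> B - p ` G) = card (B \<times> B) - card (p ` G)"
    using fin' in_B y by (intro card_Diff_subset) (auto simp: p_def G_def)
  ultimately have diff: "card (G \<inter> G' - V) \<le> card A - card G"
    by (simp only: card_BB)

  \<comment> \<open>For fixed \<open>y\<close>, \<open>e1\<close> determines \<open>e2\<close> and
    \<open>e3\<close> determines \<open>e4\<close>, so \<open>q\<close> determines the pair from
    which \<open>x\<close> is decoded.\<close>
  have "inj_on q V"
  proof (rule inj_onI)
    fix x x' assume V: "x \<in> V" "x' \<in> V" and "q x = q x'"
    then have "e2 x y = e2 x' y \<and> e4 x y = e4 x' y"
      using e2[of x x' y] e4[of x x' y] y by (auto simp: V_def G_def q_def)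
    then show "x = x'"
      using decode_x[of x x' y y] V y by (auto simp: V_def G_def)
  qed
  moreover have "inj_on q' V"
  proof (rule inj_onI)
    fix x x' assume V: "x \<in> V" "x' \<in> V" and "q' x = q' x'"
    then have "e2 x y' = e2 x' y' \<and> e4 x y' = e4 x' y'"
      using e2[of x x' y'] e4[of x x' y'] y' by (auto simp: V_def G'_def q'_def)
    then show "x = x'"
      using decode_x[of x x' y' y'] V y' by (auto simp: V_def G'_def)
  qed
  \<comment> \<open>A common value would force agreement of \<open>e1\<close>, \<open>e3\<close>
    and, by passing through \<open>(x, y')\<close>, of \<open>e4\<close>; the second terminal could
    then not tell \<open>y\<close> from \<open>y'\<close>.\<close>
  moreover have "q ` V \<inter> q' ` V = {}"
  proof (rule ccontr)
    assume "q ` V \<inter> q' ` V \<noteq> {}"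
    then obtain x x' where x: "x \<in> V" and x': "x' \<in> V" and eq: "q x = q' x'" by blast
    have A: "x \<in> A" "x' \<in> A" using x x' by (auto simp: V_def G_def)
    have "e3 x y = e3 x y'"
      using x A y y' by (intro e3) (auto simp: V_def p_def p'_def)
    then have "e3 x y' = e3 x' y'" using eq by (simp add: q_def q'_def)
    then have "e4 x y' = e4 x' y'" using A y' by (intro e4)
    then have "e4 x y = e4 x' y'" using x by (auto simp: V_def p_def p'_def)
    then have "y = y'"
      using eq x x' A y y' by (intro decode_y[of x x' y y']) (auto simp: q_def q'_def V_def G_def G'_def)
    with \<open>y \<noteq> y'\<close> show False ..
  qed
  ultimately have "2 * card V = card (q ` V \<union> q' ` V)"
    using fin' by (simp add: card_Un_disjoint card_image)
  also have "\<dots> \<le> card (B \<times> B)"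
    using fin' in_B y y' by (intro card_mono) (auto simp: q_def q'_def V_def G_def G'_def)
  finally have V: "2 * card V \<le> card A" by (simp only: card_BB)

  \<comment> \<open>With b and b' the numbers of \<open>x\<close> bad at \<open>y\<close> and
    \<open>y'\<close>, the four parts have at most b, b', b and \<open>card A\<close> / 2
    elements.\<close>
  have "A = {x \<in> A. bad x y} \<union> {x \<in> A. bad x y'} \<union> (G \<inter> G' - V) \<union> V"
    by (auto simp: G_def G'_def V_def)
  then have "card A \<le> card {x \<in> A. bad x y} + card {x \<in> A. bad x y'} + card (G \<inter> G' - V) + card V"
    using card_Un_le[of "{x \<in> A. bad x y} \<union> {x \<in> A. bad x y'} \<union> (G \<inter> G' - V)" V]
      card_Un_le[of "{x \<in> A. bad x y} \<union> {x \<in> A. bad x y'}" "G \<inter> G' - V"]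
      card_Un_le[of "{x \<in> A. bad x y}" "{x \<in> A. bad x y'}"] by simp
  moreover have "card A = card {x \<in> A. bad x y} + card G"
    using fin by (subst card_Un_disjoint[symmetric]) (auto simp: G_def intro: arg_cong[of _ _ card])
  ultimately show ?thesis using diff V by linarith
qed

text \<open>Pairing a \<open>y0\<close> that has the fewest bad \<open>x\<close> with every other
  \<open>y\<close> gives \<open>card A\<close> \<le> 4 b(y0) + 2 b(y) \<le> 6 b(y); these bounds are
  summed over \<open>y\<close> \<noteq> \<open>y0\<close>.\<close>

lemma card_le_bad_all:
  fixes bad :: "'x \<Rightarrow> 'y \<Rightarrow> bool"
  assumes fin: "finite A" "finite Y" and Y: "2 \<le> card Y"
    and pair: "\<And>y y'. y \<in> Y \<Longrightarrow> y' \<in> Y \<Longrightarrow> y \<noteq> y' \<Longrightarrow>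
        card A \<le> 4 * card {x \<in> A. bad x y} + 2 * card {x \<in> A. bad x y'}"
  shows "card A * card Y \<le> 12 * card {(x, y) \<in> A \<times> Y. bad x y}"
proof -
  define b where "b y = card {x \<in> A. bad x y}" for y
  have "Y \<noteq> {}" using Y by auto
  then obtain y0 where y0: "y0 \<in> Y" and min: "\<And>y. y \<in> Y \<Longrightarrow> b y0 \<le> b y"
    using arg_min_if_finite(1)[OF fin(2), of b] arg_min_least[OF fin(2), of _ b] by blast
  have "card {(x, y) \<in> A \<times> Y. bad x y} = card (SIGMA y:Y. {x \<in> A. bad x y})"
    by (rule bij_betw_same_card[of prod.swap]) (auto simp: bij_betw_def inj_on_def image_def)
  also have "\<dots> = (\<Sum>y\<in>Y. b y)"
    using fin by (simp add: b_def)
  finally have sum: "card {(x, y) \<in> A \<times> Y. bad x y} = (\<Sum>y\<in>Y. b y)" .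
  have "(card Y - 1) * card A = (\<Sum>y\<in>Y - {y0}. card A)"
    using y0 fin by simp
  also have "\<dots> \<le> (\<Sum>y\<in>Y - {y0}. 6 * b y)"
  proof (rule sum_mono)
    fix y assume "y \<in> Y - {y0}"
    then show "card A \<le> 6 * b y"
      using pair[OF y0, of y] min[of y] by (auto simp: b_def)
  qed
  also have "\<dots> \<le> (\<Sum>y\<in>Y. 6 * b y)"
    using fin by (intro sum_mono2) auto
  finally have "(card Y - 1) * card A \<le> 6 * (\<Sum>y\<in>Y. b y)"
    by (simp add: sum_distrib_left)
  \<comment> \<open>Since \<open>card Y\<close> \<ge> 2, leaving out \<open>y0\<close> costs at most
    a factor 2, which turns 6 into 12.\<close>
  moreover have "card Y * card A \<le> (2 * (card Y - 1)) * card A"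
    using Y by (intro mult_right_mono) auto
  ultimately have "card Y * card A \<le> 12 * (\<Sum>y\<in>Y. b y)"
    by linarith
  then show ?thesis
    unfolding sum by (simp only: mult.commute)
qed

section \<open>Blocks, and codes in an arbitrary instance\<close>

lemma finite_blocks: "finite X \<Longrightarrow> finite (blocks X T)"
  by (simp add: blocks_def finite_lists_length_eq)

lemma card_blocks: "finite X \<Longrightarrow> card (blocks X T) = card X ^ T"
  by (simp add: blocks_def card_lists_length_eq)

context multiple_unicast
begin

text \<open>Every functional dependency between edges of the concrete network comes from this, by
  comparing two message assignments.\<close>

lemma carried_cong:
  assumes "e \<in> arcs G"
    and "\<And>e'. e' \<in> in_arcs G (tail G e) \<Longrightarrow> carried C m e' = carried C m' e'"
    and "\<And>ij. ij \<in> observed (tail G e) \<Longrightarrow> m ij = m' ij"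
  shows "carried C m e = carried C m' e"
proof -
  have "restrict (carried C m) (in_arcs G (tail G e)) = restrict (carried C m') (in_arcs G (tail G e))"
    "restrict m (observed (tail G e)) = restrict m' (observed (tail G e))"
    using assms by (auto intro!: restrict_ext)
  then show ?thesis using assms(1) by (simp add: carried_eq[of e])
qed

lemma observed_subset: "observed v \<subseteq> messages"
  by (auto simp: observed_def)

lemma carried_in_blocks:
  assumes code: "block_code X T C" and m: "\<And>ij. ij \<in> messages \<Longrightarrow> m ij \<in> blocks X T"
  shows "e \<in> arcs G \<Longrightarrow> carried C m e \<in> blocks X T"
proof (induction e rule: wf_induct_rule[OF wf_arc_before])
  case (1 e)
  have "carried C m e' \<in> blocks X T" if "e' \<in> in_arcs G (tail G e)" for e'
    using that 1 by (auto simp: arc_before_def)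
  then have "restrict (carried C m) (in_arcs G (tail G e)) \<in> in_arcs G (tail G e) \<rightarrow>\<^sub>E blocks X T"
    by auto
  moreover have "restrict m (observed (tail G e)) \<in> observed (tail G e) \<rightarrow>\<^sub>E blocks X T"
    using m observed_subset by fastforce
  ultimately show ?case
    using code 1(2) carried_eq[OF 1(2), of C m] by (simp add: block_code_def)
qed

definition decoding_error :: "('e, 'x) network_code \<Rightarrow> (nat \<times> nat \<Rightarrow> 'x list) \<Rightarrow> bool" where
  "decoding_error C m \<longleftrightarrow>
     (\<exists>(i, j) \<in> messages.
        decode C i (restrict (carried C m) (in_arcs G (terminals ! i))) j \<noteq> m (i, j))"

text \<open>A terminal's estimate is a function of its incoming edges. This supplies
  \<open>decode_x\<close> and \<open>decode_y\<close> in the counting lemma.\<close>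

lemma decoded_message_eq:
  assumes "\<not> decoding_error C m" "\<not> decoding_error C m'" and "(i, j) \<in> messages"
    and "\<And>e. e \<in> in_arcs G (terminals ! i) \<Longrightarrow> carried C m e = carried C m' e"
  shows "m (i, j) = m' (i, j)"
proof -
  have "restrict (carried C m) (in_arcs G (terminals ! i)) =
      restrict (carried C m') (in_arcs G (terminals ! i))"
    using assms(4) by (auto intro: restrict_ext)
  then show ?thesis using assms(1-3) by (fastforce simp: decoding_error_def)
qed

lemma finite_messages: "finite messages"
  by (simp add: messages_def)

text \<open>Independent uniform messages are jointly uniform on the product of the block sets, so
  probabilities become counts.\<close>

lemma error_prob_eq_card:
  assumes "finite X" "X \<noteq> {}"
  shows "error_prob X T C =
    card {m \<in> PiE_dflt messages undefined (\<lambda>_. blocks X T). decoding_error C m} /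
    card (PiE_dflt messages undefined (\<lambda>_. blocks X T))"
proof -
  let ?S = "PiE_dflt messages undefined (\<lambda>_. blocks X T)"
  have ne: "blocks X T \<noteq> {}"
    using card_blocks[OF assms(1), of T] assms by auto
  have "message_pmf X T = pmf_of_set ?S"
    unfolding message_pmf_def
    by (rule Pi_pmf_of_set) (use assms ne finite_messages finite_blocks in auto)
  moreover have "finite ?S"
    using finite_messages finite_blocks[OF assms(1)] by (intro finite_PiE_dflt) auto
  moreover have "?S \<noteq> {}"
    using ne by (simp add: PiE_dflt_empty_iff)
  moreover have "?S \<inter> Collect (decoding_error C) = {m \<in> ?S. decoding_error C m}"
    by auto
  ultimately show ?thesis
    unfolding error_prob_def decoding_error_def[symmetric]
    by (simp add: measure_pmf_of_set)
qed

end

section \<open>The concrete network and its maximum flows\<close>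

lemma max_flow_eqI:
  assumes "unit_capacity_flow G s t f" and "flow_value G s f = k"
    and "\<And>f. unit_capacity_flow G s t f \<Longrightarrow> flow_value G s f \<le> k"
  shows "max_flow G s t = k"
  unfolding max_flow_def by (rule Greatest_equality) (use assms in auto)

text \<open>The sources are 0 and 1, the terminals 10 and 11; the arcs 5, 8, 11, 14 carry
  \<open>e\<^sub>1, e\<^sub>2, e\<^sub>3, e\<^sub>4\<close>.\<close>

definition N_ends :: "(nat \<times> nat) list" where
  "N_ends = [(0,2), (0,6), (1,2), (1,4), (1,8), (2,3), (3,4), (3,11), (4,5), (5,6), (5,10),
     (6,7), (7,8), (7,11), (8,9), (9,10), (9,11)]"

definition N :: "(nat, nat) pre_digraph" where
  "N = \<lparr>verts = {0,1,2,3,4,5,6,7,8,9,10,11},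
     arcs = {0,1,2,3,4,5,6,7,8,9,10,11,12,13,14,15,16},
     tail = (\<lambda>e. fst (N_ends ! e)), head = (\<lambda>e. snd (N_ends ! e))\<rparr>"

text \<open>Otherwise the simplifier turns vertex, arc and session \<open>1\<close> into \<open>Suc 0\<close>, and the
  facts about \<open>N\<close> below no longer match.\<close>

declare One_nat_def [simp del]

lemma N_tail: "tail N 0 = 0" "tail N 1 = 0" "tail N 2 = 1" "tail N 3 = 1" "tail N 4 = 1"
  "tail N 5 = 2" "tail N 6 = 3" "tail N 7 = 3" "tail N 8 = 4" "tail N 9 = 5" "tail N 10 = 5"
  "tail N 11 = 6" "tail N 12 = 7" "tail N 13 = 7" "tail N 14 = 8" "tail N 15 = 9" "tail N 16 = 9"
  by (simp_all add: N_def N_ends_def)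

lemma N_head: "head N 0 = 2" "head N 1 = 6" "head N 2 = 2" "head N 3 = 4" "head N 4 = 8"
  "head N 5 = 3" "head N 6 = 4" "head N 7 = 11" "head N 8 = 5" "head N 9 = 6" "head N 10 = 10"
  "head N 11 = 7" "head N 12 = 8" "head N 13 = 11" "head N 14 = 9" "head N 15 = 10" "head N 16 = 11"
  by (simp_all add: N_def N_ends_def)

lemma N_verts: "verts N = {0,1,2,3,4,5,6,7,8,9,10,11}"
  by (simp add: N_def)

lemma N_arcs: "arcs N = {0,1,2,3,4,5,6,7,8,9,10,11,12,13,14,15,16}"
  by (simp add: N_def)

text \<open>Evaluates a filter on an explicit arc set one arc at a time; \<open>insert_iff\<close>
  is disabled at its uses, as it would break up the membership first.\<close>

lemma Collect_in_insert:
  "{e. e \<in> insert a A \<and> P e} = (if P a then insert a {e. e \<in> A \<and> P e} else {e. e \<in> A \<and> P e})"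
  by auto

lemma N_in_arcs: "in_arcs N 0 = {}" "in_arcs N 1 = {}" "in_arcs N 2 = {0,2}" "in_arcs N 3 = {5}"
  "in_arcs N 4 = {3,6}" "in_arcs N 5 = {8}" "in_arcs N 6 = {1,9}" "in_arcs N 7 = {11}"
  "in_arcs N 8 = {4,12}" "in_arcs N 9 = {14}" "in_arcs N 10 = {10,15}" "in_arcs N 11 = {7,13,16}"
  unfolding in_arcs_def N_arcs by (simp_all add: Collect_in_insert N_head del: insert_iff)

lemma N_out_arcs: "out_arcs N 0 = {0,1}" "out_arcs N 1 = {2,3,4}" "out_arcs N 2 = {5}"
  "out_arcs N 3 = {6,7}" "out_arcs N 4 = {8}" "out_arcs N 5 = {9,10}" "out_arcs N 6 = {11}"
  "out_arcs N 7 = {12,13}" "out_arcs N 8 = {14}" "out_arcs N 9 = {15,16}"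
  "out_arcs N 10 = {}" "out_arcs N 11 = {}"
  unfolding out_arcs_def N_arcs by (simp_all add: Collect_in_insert N_tail del: insert_iff)

lemma multiple_unicast_N: "multiple_unicast N [0, 1] [10, 11] [2, 1]"
proof
  show "tail N e \<in> verts N" "head N e \<in> verts N" if "e \<in> arcs N" for e
    using that unfolding N_arcs N_verts by (auto simp: N_tail N_head)
  \<comment> \<open>The vertices are numbered in topological order.\<close>
  have "arcs_ends N \<subseteq> {(u, v). u < v}"
    unfolding arcs_ends_def arc_to_ends_def N_arcs by (auto simp: N_tail N_head)
  moreover have "acyclic {(u, v :: nat). u < v}"
    using wf_less by (rule wf_acyclic)
  ultimately show "acyclic (arcs_ends N)"
    by (rule acyclic_subset[rotated])
qed (auto simp: N_verts N_arcs N_in_arcs N_out_arcs)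

interpretation N: multiple_unicast N "[0, 1]" "[10, 11]" "[2, 1]"
  by (rule multiple_unicast_N)

lemma connectivity_level_N: "N.connectivity_level = [2, 3]"
proof -
  have "max_flow N 0 10 = 2"
  proof (rule max_flow_eqI)
    \<comment> \<open>Unit flow along the edge-disjoint paths 0-2-3-4-5-10 and 0-6-7-8-9-10; the
      arcs leaving the source give the upper bound.\<close>
    let ?f = "\<lambda>e. if e \<in> {0,1,5,6,8,10,11,12,14,15 :: nat} then 1 else 0 :: real"
    show "unit_capacity_flow N 0 10 ?f"
      unfolding unit_capacity_flow_def N_verts
      by (auto simp: N_in_arcs N_out_arcs)
    show "flow_value N 0 ?f = 2"
      by (simp add: flow_value_def N_in_arcs N_out_arcs)
    show "flow_value N 0 f \<le> 2" if "unit_capacity_flow N 0 10 f" for f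
    proof -
      have "f 0 \<le> 1" "f 1 \<le> 1" using that by (auto simp: unit_capacity_flow_def N_arcs)
      then show ?thesis by (simp add: flow_value_def N_in_arcs N_out_arcs)
    qed
  qed
  moreover have "max_flow N 1 11 = 3"
  proof (rule max_flow_eqI)
    \<comment> \<open>Unit flow along the paths 1-2-3-11, 1-4-5-6-7-11 and 1-8-9-11.\<close>
    let ?f = "\<lambda>e. if e \<in> {2,3,4,5,7,8,9,11,13,14,16 :: nat} then 1 else 0 :: real"
    show "unit_capacity_flow N 1 11 ?f"
      unfolding unit_capacity_flow_def N_verts
      by (auto simp: N_in_arcs N_out_arcs)
    show "flow_value N 1 ?f = 3"
      by (simp add: flow_value_def N_in_arcs N_out_arcs)
    show "flow_value N 1 f \<le> 3" if "unit_capacity_flow N 1 11 f" for f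
    proof -
      have "f 2 \<le> 1" "f 3 \<le> 1" "f 4 \<le> 1" using that by (auto simp: unit_capacity_flow_def N_arcs)
      then show ?thesis by (simp add: flow_value_def N_in_arcs N_out_arcs)
    qed
  qed
  ultimately show ?thesis by (simp add: N.connectivity_level_def)
qed

section \<open>Lower bound on the error probability, and infeasibility\<close>

lemma N_messages: "N.messages = {(0,0), (0,1), (1,0)}"
  unfolding N.messages_def by (auto simp: less_Suc_eq numeral_2_eq_2 One_nat_def)

lemma N_observed: "N.observed 0 = {(0,0), (0,1)}" "N.observed 1 = {(1,0)}"
  "v \<noteq> 0 \<Longrightarrow> v \<noteq> 1 \<Longrightarrow> N.observed v = {}"
  by (auto simp: N.observed_def N_messages nth_Cons split: nat.splits)

text \<open>The two messages of the first session form one value \<open>x\<close>. The default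
  \<open>undefined\<close> matches that of \<open>PiE_dflt\<close>.\<close>

definition message_tuple :: "'w \<times> 'w \<Rightarrow> 'w \<Rightarrow> nat \<times> nat \<Rightarrow> 'w" where
  "message_tuple x y = (\<lambda>_. undefined)((0,0) := fst x, (0,1) := snd x, (1,0) := y)"

lemma message_tuple_simps:
  "message_tuple x y (0,0) = fst x" "message_tuple x y (0,1) = snd x" "message_tuple x y (1,0) = y"
  by (simp_all add: message_tuple_def)

text \<open>Transfers counts of message assignments to counts of pairs
  \<open>(x, y)\<close>.\<close>

lemma bij_betw_message_tuple:
  "bij_betw (\<lambda>(x, y). message_tuple x y) ((B \<times> B) \<times> B) (PiE_dflt N.messages undefined (\<lambda>_. B))"
  unfolding bij_betw_def
proof
  show "inj_on (\<lambda>(x, y). message_tuple x y) ((B \<times> B) \<times> B)"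
  proof (rule inj_onI, clarify)
    fix x1 x2 y x1' x2' y' :: 'a
    assume "message_tuple (x1, x2) y = message_tuple (x1', x2') y'"
    then have "message_tuple (x1, x2) y ij = message_tuple (x1', x2') y' ij" for ij
      by simp
    from this[of "(0,0)"] this[of "(0,1)"] this[of "(1,0)"]
    show "(x1, x2) = (x1', x2') \<and> y = y'"
      by (simp add: message_tuple_def)
  qed
  show "(\<lambda>(x, y). message_tuple x y) ` ((B \<times> B) \<times> B) = PiE_dflt N.messages undefined (\<lambda>_. B)"
  proof (intro equalityI subsetI)
    fix m assume m: "m \<in> PiE_dflt N.messages undefined (\<lambda>_. B)"
    then have "m = message_tuple (m (0,0), m (0,1)) (m (1,0))"
      by (auto simp: PiE_dflt_def N_messages message_tuple_def fun_eq_iff)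
    moreover have "m (0,0) \<in> B" "m (0,1) \<in> B" "m (1,0) \<in> B"
      using m by (auto simp: PiE_dflt_def N_messages)
    ultimately show "m \<in> (\<lambda>(x, y). message_tuple x y) ` ((B \<times> B) \<times> B)"
      by (intro image_eqI[of _ _ "((m (0,0), m (0,1)), m (1,0))"]) auto
  qed (auto simp: PiE_dflt_def N_messages message_tuple_def)
qed

text \<open>The counting lemmas are applied with \<open>B \<times> B\<close> for the values of
  \<open>x\<close> and \<open>B\<close> for those of \<open>y\<close>; \<open>0 < T\<close> ensures
  two distinct values of \<open>y\<close>.\<close>

lemma error_prob_N_ge:
  assumes X: "finite X" "2 \<le> card X" and T: "0 < T" and code: "N.block_code X T C"
  shows "1 / 12 \<le> N.error_prob X T C"
proof -
  define B where "B = blocks X T"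
  define z where "z x y = N.carried C (message_tuple x y)" for x y
  define bad where "bad x y = N.decoding_error C (message_tuple x y)" for x y
  have fin: "finite B"
    unfolding B_def by (rule finite_blocks) fact
  have "2 \<le> card X ^ T"
    using X T by (metis One_nat_def Suc_leI le_trans self_le_power zero_less_numeral
        order.strict_trans2 less_numeral_extra(1) one_le_numeral)
  then have card: "2 \<le> card B"
    using X by (simp add: B_def card_blocks)
  have in_B: "z x y e \<in> B" if "x \<in> B \<times> B" "y \<in> B" "e \<in> arcs N" for x y e
    unfolding z_def B_def
    by (rule N.carried_in_blocks[OF code])
      (use that in \<open>auto simp: N_messages message_tuple_simps B_def\<close>)
  have cong: "z x y e = z x' y' e"
    if e: "e \<in> arcs N" and ins: "\<And>e'. e' \<in> in_arcs N (tail N e) \<Longrightarrow> z x y e' = z x' y' e'"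
      and src: "tail N e = 0 \<Longrightarrow> x = x'" "tail N e = 1 \<Longrightarrow> y = y'" for x y x' y' e
  proof -
    have "message_tuple x y ij = message_tuple x' y' ij" if "ij \<in> N.observed (tail N e)" for ij
    proof -
      consider "tail N e = 0" | "tail N e = 1" | "tail N e \<noteq> 0" "tail N e \<noteq> 1"
        by blast
      then show ?thesis
      proof cases
        case 1
        then have "x = x'" by (rule src(1))
        moreover have "ij \<in> {(0,0), (0,1)}" using that unfolding 1 N_observed(1) .
        ultimately show ?thesis by (elim insertE emptyE) (simp_all only: message_tuple_simps)
      next
        case 2
        then have "y = y'" by (rule src(2))
        moreover have "ij \<in> {(1,0)}" using that unfolding 2 N_observed(2) .
        ultimately show ?thesis by (elim insertE emptyE) (simp_all only: message_tuple_simps)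
      qed (use that N_observed(3) in simp)
    qed
    from N.carried_cong[OF e ins[unfolded z_def] this] show ?thesis
      unfolding z_def .
  qed
  note N_simps = N_arcs N_tail N_in_arcs
  \<comment> \<open>The arcs leaving a source carry functions of its messages alone: a, b of
    \<open>x\<close>, and the three c's of \<open>y\<close>.\<close>
  have src1: "z x y e = z x y' e" if "e \<in> {0, 1}" for x y y' e
    by (rule cong) (use that in \<open>auto simp: N_simps simp del: in_in_arcs_conv\<close>)
  have src2: "z x y e = z x' y e" if "e \<in> {2, 3, 4}" for x x' y e
    by (rule cong) (use that in \<open>auto simp: N_simps simp del: in_in_arcs_conv\<close>)
  \<comment> \<open>Vertices 3, 5, 7, 9 have one incoming arc and observe nothing. Their outgoing
    arcs may carry any functions of it, not only copies.\<close>
  have copy1: "z x y e = z x' y' e" if "z x y 5 = z x' y' 5" "e \<in> {6, 7}" for x y x' y' e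
    by (rule cong) (use that in \<open>auto simp: N_simps simp del: in_in_arcs_conv\<close>)
  have copy2: "z x y e = z x' y' e" if "z x y 8 = z x' y' 8" "e \<in> {9, 10}" for x y x' y' e
    by (rule cong) (use that in \<open>auto simp: N_simps simp del: in_in_arcs_conv\<close>)
  have copy3: "z x y e = z x' y' e" if "z x y 11 = z x' y' 11" "e \<in> {12, 13}" for x y x' y' e
    by (rule cong) (use that in \<open>auto simp: N_simps simp del: in_in_arcs_conv\<close>)
  have copy4: "z x y e = z x' y' e" if "z x y 14 = z x' y' 14" "e \<in> {15, 16}" for x y x' y' e
    by (rule cong) (use that in \<open>auto simp: N_simps simp del: in_in_arcs_conv\<close>)
  have pair: "card (B \<times> B) \<le>
      4 * card {x \<in> B \<times> B. bad x y} + 2 * card {x \<in> B \<times> B. bad x y'}"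
    if "y \<in> B" "y' \<in> B" "y \<noteq> y'" for y y'
  proof (rule card_le_bad_pair[where B = B and Y = B and ?e1.0 = "\<lambda>x y. z x y 5"
        and ?e2.0 = "\<lambda>x y. z x y 8" and ?e3.0 = "\<lambda>x y. z x y 11" and ?e4.0 = "\<lambda>x y. z x y 14"])
    show "z x y 5 \<in> B \<and> z x y 8 \<in> B \<and> z x y 11 \<in> B \<and> z x y 14 \<in> B"
      if "x \<in> B \<times> B" "y \<in> B" for x y
      using that by (simp add: in_B N_arcs)
    show "z x y 8 = z x' y 8" if "z x y 5 = z x' y 5" for x x' y
      by (rule cong)
        (use src2[of 3 x y x'] copy1[OF that, of 6] in \<open>auto simp: N_simps simp del: in_in_arcs_conv\<close>)
    \<comment> \<open>Arc 11 is fed by b on arc 1, which depends on \<open>x\<close> alone, and a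
      function of \<open>e2\<close> on arc 9; hence \<open>x\<close> is fixed and \<open>y\<close>
      varies.\<close>
    show "z x y 11 = z x y' 11" if "z x y 8 = z x y' 8" for x y y'
      by (rule cong)
        (use src1[of 1 x y y'] copy2[OF that, of 9] in \<open>auto simp: N_simps simp del: in_in_arcs_conv\<close>)
    show "z x y 14 = z x' y 14" if "z x y 11 = z x' y 11" for x x' y
      by (rule cong)
        (use src2[of 4 x y x'] copy3[OF that, of 12] in \<open>auto simp: N_simps simp del: in_in_arcs_conv\<close>)
    show "x = x'" if good: "\<not> bad x y" "\<not> bad x' y'"
      and eq: "z x y 8 = z x' y' 8" "z x y 14 = z x' y' 14" for x x' y y'
    proof -
      have "message_tuple x y (0, j) = message_tuple x' y' (0, j)" if "(0, j) \<in> N.messages" for j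
        by (rule N.decoded_message_eq[OF good[unfolded bad_def] that])
          (use copy2[OF eq(1), of 10] copy4[OF eq(2), of 15]
            in \<open>auto simp: N_simps z_def simp del: in_in_arcs_conv\<close>)
      from this[of 0] this[of 1] show ?thesis
        by (simp add: N_messages message_tuple_simps prod_eq_iff)
    qed
    \<comment> \<open>The terminal 11 receives functions of \<open>e1\<close>, \<open>e3\<close>,
      \<open>e4\<close> on arcs 7, 13, 16.\<close>
    show "y = y'" if good: "\<not> bad x y" "\<not> bad x' y'"
      and eq: "z x y 5 = z x' y' 5" "z x y 11 = z x' y' 11" "z x y 14 = z x' y' 14" for x x' y y'
    proof -
      have "message_tuple x y (1, 0) = message_tuple x' y' (1, 0)"
        by (rule N.decoded_message_eq[OF good[unfolded bad_def]])
          (use copy1[OF eq(1), of 7] copy3[OF eq(2), of 13] copy4[OF eq(3), of 16]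
            in \<open>auto simp: N_simps N_messages z_def simp del: in_in_arcs_conv\<close>)
      then show ?thesis by (simp add: message_tuple_simps)
    qed
  qed (use that fin in \<open>auto simp: power2_eq_square\<close>)
  have le: "card (B \<times> B) * card B \<le> 12 * card {(x, y) \<in> (B \<times> B) \<times> B. bad x y}"
    by (rule card_le_bad_all) (use fin card pair in auto)
  let ?S = "PiE_dflt N.messages undefined (\<lambda>_. B)"
  let ?f = "\<lambda>(x, y). message_tuple x y"
  note bij = bij_betw_message_tuple[of B]
  have S: "card ?S = card (B \<times> B) * card B"
    using bij_betw_same_card[OF bij] by (simp add: card_cartesian_product)
  have "{m \<in> ?S. N.decoding_error C m} =
      ?f ` {xy \<in> (B \<times> B) \<times> B. N.decoding_error C (?f xy)}"
    unfolding bij_betw_imp_surj_on[OF bij, symmetric] by blast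
  also have "{xy \<in> (B \<times> B) \<times> B. N.decoding_error C (?f xy)} =
      {(x, y) \<in> (B \<times> B) \<times> B. bad x y}"
    unfolding bad_def by (intro set_eqI) (simp only: split_paired_all mem_Collect_eq prod.case)
  finally have "{m \<in> ?S. N.decoding_error C m} = ?f ` {(x, y) \<in> (B \<times> B) \<times> B. bad x y}" .
  moreover have "inj_on ?f {(x, y) \<in> (B \<times> B) \<times> B. bad x y}"
    using bij_betw_imp_inj_on[OF bij] by (rule inj_on_subset) (simp add: subset_iff)
  ultimately have "card {m \<in> ?S. N.decoding_error C m} = card {(x, y) \<in> (B \<times> B) \<times> B. bad x y}"
    by (simp only: card_image)
  with le S have "card ?S \<le> 12 * card {m \<in> ?S. N.decoding_error C m}" by (simp only:)
  then have le': "real (card ?S) \<le> 12 * real (card {m \<in> ?S. N.decoding_error C m})"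
    by (simp only: of_nat_le_iff[where ?'a = real, symmetric] of_nat_mult of_nat_numeral)
  have pos: "0 < real (card ?S)"
    using card unfolding S of_nat_0_less_iff by (simp add: card_cartesian_product)
  have "N.error_prob X T C = card {m \<in> ?S. N.decoding_error C m} / card ?S"
    unfolding B_def by (rule N.error_prob_eq_card) (use X in auto)
  moreover have "1 / 12 \<le> a / b" if "b \<le> 12 * a" "0 < b" for a b :: real
    using that by (simp add: field_simps)
  ultimately show ?thesis using le' pos by (simp only:)
qed

lemma infeasible_N: "N.infeasible"
  unfolding N.infeasible_def
proof (intro allI impI notI, elim exE conjE)
  fix X :: "nat set" and T :: "nat \<Rightarrow> nat" and C :: "nat \<Rightarrow> (nat, nat) network_code"
  assume X: "finite X" "2 \<le> card X" and T: "filterlim T at_top sequentially"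
    and code: "\<forall>k. N.block_code X (T k) (C k)"
    and lim: "(\<lambda>k. N.error_prob X (T k) (C k)) \<longlonglongrightarrow> 0"
  \<comment> \<open>Block length 0 must be excluded, since there is then only one block; afterwards
    the bound 1/12 is uniform in the block length.\<close>
  have "\<forall>\<^sub>F k in sequentially. 1 \<le> T k"
    using T unfolding filterlim_at_top by blast
  moreover have "\<forall>\<^sub>F k in sequentially. N.error_prob X (T k) (C k) < 1 / 12"
    using lim by (rule order_tendstoD) simp
  ultimately have "\<forall>\<^sub>F k in sequentially. False"
  proof eventually_elim
    case (elim k)
    then show False using error_prob_N_ge[OF X, of "T k" "C k"] code by auto
  qed
  then show False by simp
qed

theorem mainTheorem3:
  shows "\<exists>(G :: (nat, nat) pre_digraph) s1 s2 t1 t2.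
    multiple_unicast G [s1, s2] [t1, t2] [2, 1] \<and>
    multiple_unicast.connectivity_level G [s1, s2] [t1, t2] = [2, 3] \<and>
    multiple_unicast.infeasible G [s1, s2] [t1, t2] [2, 1]"
  using multiple_unicast_N connectivity_level_N infeasible_N by blast

end
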